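(* Let $V=\{1,\ldots,n\}$, let $k$ be a positive integer, and let $f:2^V\to\mathbb{R}_+$ be a non-negative, normalized ($f(\emptyset)=0$), monotone submodular function which is $(c,\theta)$-submodular sharp for some $c\ge1$ and $\theta\in[0,1]$. Then the greedy algorithm returns a feasible set $S^g$ for the problem $\max\{f(S):|S|\le k\}$ such that \[ f(S^g)\ \ge\ \left[1-\left(1-\frac{\theta}{c}\right)^{\frac{1}{\theta}}\right]\cdot f(S^* ), \] where $S^*$ is an optimal solution.
   Context: For $A\subseteq V$ and $e\in V$, $f_A(e):=f(A\cup\{e\})-f(A)$. $f$ is submodular if $f_A(e)\ge f_B(e)$ for all $A\subseteq B\subseteq V\setminus\{e\}$; monotone if $f(A)\le f(B)$ for $A\subseteq B$. The problem is $\max\{f(S):S\subseteq V,|S|\le k\}$ with optimal value $\mathrm{OPT}$. $f$ is $(c,\theta)$-submodular sharp if there exists an optimal solution $S^*$ such that for every $S\subseteq V$ with $|S|\le k$, \[ \max_{e\in S^*\setminus S} f_S(e)\ \ge\ \frac{1}{kc}\,[f(S^* )-f(S)]^{1-\theta}\,\mathrm{OPT}^{\theta}. \] The greedy algorithm starts with $S=\emptyset$ and, while $|S|<k$, adds to $S$ an element of $\arg\max_{e\in V\setminus S} f_S(e)$; its output is $S^g$. *)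

theory Defs
  imports Complex_Main "HOL-Real_Asymp.Real_Asymp"
begin

definition marginal :: "('a set \<Rightarrow> real) \<Rightarrow> 'a set \<Rightarrow> 'a \<Rightarrow> real" where
  "marginal f A e = f (A \<union> {e}) - f A"

definition submodular :: "'a set \<Rightarrow> ('a set \<Rightarrow> real) \<Rightarrow> bool" where
  "submodular V f \<longleftrightarrow>
     (\<forall>e\<in>V. \<forall>A B. A \<subseteq> B \<and> B \<subseteq> V - {e} \<longrightarrow> marginal f A e \<ge> marginal f B e)"

definition monotone_set_fun :: "'a set \<Rightarrow> ('a set \<Rightarrow> real) \<Rightarrow> bool" where
  "monotone_set_fun V f \<longleftrightarrow> (\<forall>A B. A \<subseteq> B \<and> B \<subseteq> V \<longrightarrow> f A \<le> f B)"

definition feasible :: "'a set \<Rightarrow> nat \<Rightarrow> 'a set \<Rightarrow> bool" where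
  "feasible V k S \<longleftrightarrow> S \<subseteq> V \<and> card S \<le> k"

text \<open>The ground set \<open>V\<close> is always finite here, so the maximum exists.\<close>

definition OPT :: "'a set \<Rightarrow> ('a set \<Rightarrow> real) \<Rightarrow> nat \<Rightarrow> real" where
  "OPT V f k = Max (f ` {S. feasible V k S})"

definition optimal_solution :: "'a set \<Rightarrow> ('a set \<Rightarrow> real) \<Rightarrow> nat \<Rightarrow> 'a set \<Rightarrow> bool" where
  "optimal_solution V f k S \<longleftrightarrow> feasible V k S \<and> f S = OPT V f k"

text \<open>
  Sets \<open>S\<close> containing \<open>S\<^sup>*\<close> are excluded, since the maximum over the empty set is
  undefined; for monotone \<open>f\<close> they satisfy \<open>f S = f S\<^sup>*\<close>.
  Where \<open>0\<^sup>0\<close> arises (\<open>\<theta> = 1\<close> and \<open>f S = f S\<^sup>*\<close>, or \<open>\<theta> = 0\<close> and \<open>OPT = 0\<close>), the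
  convention \<open>0 powr 0 = 0\<close> makes the right-hand side \<open>0\<close>. Reading \<open>0\<^sup>0\<close> as \<open>1\<close> changes
  only the former case, where it would make the condition more restrictive.
\<close>

definition submodular_sharp ::
  "'a set \<Rightarrow> ('a set \<Rightarrow> real) \<Rightarrow> nat \<Rightarrow> real \<Rightarrow> real \<Rightarrow> bool" where
  "submodular_sharp V f k c \<theta> \<longleftrightarrow>
     (\<exists>Sopt. optimal_solution V f k Sopt \<and>
       (\<forall>S. S \<subseteq> V \<and> card S \<le> k \<and> Sopt - S \<noteq> {} \<longrightarrow>
          Max (marginal f S ` (Sopt - S))
            \<ge> 1 / (real k * c) * (f Sopt - f S) powr (1 - \<theta>) * OPT V f k powr \<theta>))"

text \<open>
  The sets the greedy algorithm may hold during its execution, ties being broken arbitrarily.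
  It stops once \<open>S\<close> has \<open>k\<close> elements, or when \<open>V\<close> is exhausted (in case \<open>k > card V\<close>).
\<close>

inductive greedy_reach :: "'a set \<Rightarrow> ('a set \<Rightarrow> real) \<Rightarrow> nat \<Rightarrow> 'a set \<Rightarrow> bool"
  for V f k where
  start: "greedy_reach V f k {}"
| step: "greedy_reach V f k (insert e S)"
    if "greedy_reach V f k S" "card S < k"
       "is_arg_max (marginal f S) (\<lambda>x. x \<in> V - S) e"

definition greedy_output :: "'a set \<Rightarrow> ('a set \<Rightarrow> real) \<Rightarrow> nat \<Rightarrow> 'a set \<Rightarrow> bool" where
  "greedy_output V f k S \<longleftrightarrow>
     greedy_reach V f k S \<and> \<not> (card S < k \<and> V - S \<noteq> {})"

text \<open>
  The quantity \<open>(1 - \<theta>/c)\<close> to the power \<open>1/\<theta>\<close>, extended to \<open>\<theta> = 0\<close> by its limit.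
\<close>

definition sharp_factor :: "real \<Rightarrow> real \<Rightarrow> real" where
  "sharp_factor c \<theta> = (if \<theta> = 0 then exp (- (1 / c)) else (1 - \<theta> / c) powr (1 / \<theta>))"

lemma sharp_factor_tendsto_0:
  assumes "c > 0"
  shows "(sharp_factor c \<longlongrightarrow> sharp_factor c 0) (at_right 0)"
proof -
  have "((\<lambda>t. (1 - t / c) powr (1 / t)) \<longlongrightarrow> exp (- (1 / c))) (at_right 0)"
    using assms by (real_asymp simp: field_simps)
  moreover have "\<forall>\<^sub>F t in at_right 0. (1 - t / c) powr (1 / t) = sharp_factor c t"
    by (auto simp: sharp_factor_def eventually_at_filter)
  ultimately show ?thesis
    by (simp add: sharp_factor_def[of c 0] tendsto_cong)
qed

end

theory Submission
  imports Defs "HOL-Analysis.Convex"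
begin

text \<open>
  Let \<open>d\<close> be the gap \<open>OPT - f S\<close> of the current greedy set. Sharpness says that a greedy
  step decreases \<open>d\<close> by at least \<open>OPT powr \<theta> / (k * c) * d powr (1 - \<theta>)\<close>. For \<open>\<theta> > 0\<close>,
  concavity of \<open>x powr \<theta>\<close> turns this into a decrease of \<open>d powr \<theta>\<close> by the constant
  \<open>\<theta> / (k * c) * OPT powr \<theta>\<close>; for \<open>\<theta> = 0\<close> the gap shrinks by the factor \<open>1 - 1 / (k * c)\<close>.
  After \<open>k\<close> steps this is the claimed bound.
\<close>

section \<open>Real inequalities for powers\<close>

text \<open>Concavity in the form of Young's inequality with weights \<open>\<theta>\<close> and
  \<open>1 - \<theta>\<close> at the points \<open>y\<close> and 1. That inequality wants positive
  points, hence the separate case \<open>y = 0\<close>.\<close>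

lemma powr_le_tangent_at_1:
  fixes y \<theta> :: real
  assumes "0 \<le> y" "0 < \<theta>" "\<theta> \<le> 1"
  shows "y powr \<theta> \<le> 1 + \<theta> * (y - 1)"
proof (cases "y = 0")
  case False
  then show ?thesis
    using Youngs_inequality_0[of \<theta> "1 - \<theta>" y 1] assms by (simp add: algebra_simps)
qed (use assms in simp)

text \<open>Discrete form of: if x' <= -t x^(1-\<theta>), then (x^\<theta>)' <= -\<theta> t. The
  tangent bound, applied to the ratio \<open>b / a\<close>, replaces the chain rule.\<close>

lemma powr_decrease:
  fixes a b t \<theta> :: real
  assumes "0 < \<theta>" "\<theta> \<le> 1" "0 \<le> t" "0 < a" "0 \<le> b" and step: "b \<le> a - t * a powr (1 - \<theta>)"
  shows "b powr \<theta> \<le> a powr \<theta> - \<theta> * t"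
proof -
  have a: "a powr \<theta> * a powr (1 - \<theta>) = a" "a powr \<theta> > 0"
    using \<open>0 < a\<close> by (simp_all flip: powr_add)
  have "b powr \<theta> = a powr \<theta> * (b / a) powr \<theta>"
    using assms by (simp add: powr_divide)
  also have "\<dots> \<le> a powr \<theta> * (1 + \<theta> * (b / a - 1))"
    using assms by (intro mult_left_mono powr_le_tangent_at_1) auto
  also have "\<dots> \<le> a powr \<theta> * (1 + \<theta> * (- t / a powr \<theta>))"
  proof -
    have "b / a \<le> 1 - t * a powr (1 - \<theta>) / a"
      using step \<open>0 < a\<close> by (simp add: field_simps)
    also have "t * a powr (1 - \<theta>) / a = t / a powr \<theta>"
      using a \<open>0 < a\<close> by (simp add: field_simps)
    finally show ?thesis
      using assms by (intro mult_left_mono add_left_mono) auto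
  qed
  also have "\<dots> = a powr \<theta> - \<theta> * t"
    using a by (simp add: field_simps)
  finally show ?thesis .
qed

section \<open>Feasibility and termination of the greedy process\<close>

lemma greedy_reach_feasible:
  assumes "greedy_reach V f k S" "finite V"
  shows "feasible V k S"
  using assms(1)
proof induction
  case start
  show ?case by (simp add: feasible_def)
next
  case (step S e)
  then have "finite S" "e \<in> V - S"
    using assms(2) by (auto simp: feasible_def is_arg_max_def dest: finite_subset)
  with step show ?case by (simp add: feasible_def)
qed

lemma greedy_reach_card:
  assumes "finite V" "j \<le> k" "j \<le> card V"
  shows "\<exists>S. greedy_reach V f k S \<and> card S = j"
  using assms(2,3)
proof (induction j)
  case 0
  show ?case by (intro exI[of _ "{}"]) (simp add: greedy_reach.start)
next
  case (Suc j)
  then obtain S where S: "greedy_reach V f k S" "card S = j" by auto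
  then have "finite S" "S \<subseteq> V"
    using greedy_reach_feasible[OF S(1) assms(1)] assms(1)
    by (auto simp: feasible_def dest: finite_subset)
  with S Suc.prems have ne: "V - S \<noteq> {}"
    using card_mono[of S V] by auto
  then have "Max (marginal f S ` (V - S)) \<in> marginal f S ` (V - S)"
    using assms(1) by (intro Max_in) auto
  then obtain e where "e \<in> V - S" "marginal f S e = Max (marginal f S ` (V - S))"
    by force
  then have e: "is_arg_max (marginal f S) (\<lambda>x. x \<in> V - S) e"
    using assms(1) by (simp add: is_arg_max_linorder)
  have "greedy_reach V f k (insert e S)"
    using S Suc.prems e by (intro greedy_reach.step) auto
  moreover have "card (insert e S) = Suc j"
    using e S \<open>finite S\<close> by (simp add: is_arg_max_def)
  ultimately show ?case by blast
qed

text \<open>Ensures that a statement about all greedy outputs is not vacuous. The cardinality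
  \<open>min k (card V)\<close> covers both ways of stopping: \<open>k\<close> elements chosen, or
  \<open>V\<close> exhausted.\<close>

lemma greedy_output_exists:
  assumes "finite V"
  shows "\<exists>S. greedy_output V f k S"
proof -
  obtain S where S: "greedy_reach V f k S" "card S = min k (card V)"
    using greedy_reach_card[OF assms, of "min k (card V)" k f] by auto
  moreover have "S \<subseteq> V"
    using greedy_reach_feasible[OF S(1) assms] by (simp add: feasible_def)
  ultimately show ?thesis
    using assms card_subset_eq[of V S] by (auto simp: greedy_output_def min_def split: if_splits)
qed

lemma le_OPT:
  assumes "finite V" "feasible V k S"
  shows "f S \<le> OPT V f k"
proof -
  have "finite {S. feasible V k S}"
    using assms(1) by (rule_tac finite_subset[of _ "Pow V"]) (auto simp: feasible_def)
  then show ?thesis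
    using assms(2) by (auto simp: OPT_def intro: Max_ge)
qed

section \<open>Decrease of the gap along a greedy run\<close>

text \<open>Sharpness bounds the best marginal over \<open>Sopt - S\<close>, and the greedy element
  does at least as well because it maximizes over the larger set \<open>V - S\<close>.\<close>

lemma greedy_gap_step:
  assumes "finite V" and mono: "monotone_set_fun V f"
    and sharp: "submodular_sharp V f k c \<theta>"
    and reach: "greedy_reach V f k S"
    and e: "is_arg_max (marginal f S) (\<lambda>x. x \<in> V - S) e"
  defines "d \<equiv> OPT V f k - f S"
  shows "OPT V f k - f (insert e S) \<le> d - OPT V f k powr \<theta> / (real k * c) * d powr (1 - \<theta>)"
proof -
  obtain Sopt where Sopt: "optimal_solution V f k Sopt"
    and max_ge: "\<And>S. S \<subseteq> V \<Longrightarrow> card S \<le> k \<Longrightarrow> Sopt - S \<noteq> {} \<Longrightarrow>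
      Max (marginal f S ` (Sopt - S))
        \<ge> 1 / (real k * c) * (f Sopt - f S) powr (1 - \<theta>) * OPT V f k powr \<theta>"
    using sharp by (auto simp: submodular_sharp_def)
  have S: "S \<subseteq> V" "card S \<le> k" "f S \<le> OPT V f k"
    using greedy_reach_feasible[OF reach] le_OPT[of V k S f] assms(1)
    by (auto simp: feasible_def)
  have opt: "Sopt \<subseteq> V" "f Sopt = OPT V f k"
    using Sopt by (auto simp: optimal_solution_def feasible_def)
  show ?thesis
  proof (cases "Sopt \<subseteq> S")
    case True
    \<comment> \<open>Sharpness is silent here, but the gap is already 0. The required decrease is
      then 0 as well, even for \<open>\<theta> = 1\<close>, since
      \<open>0 powr 0 = 0\<close>.\<close>
    then have "f Sopt \<le> f S"
      using mono S(1) unfolding monotone_set_fun_def by blast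
    then have "d = 0"
      using S(3) opt(2) by (simp add: d_def)
    moreover have "f S \<le> f (insert e S)"
      using mono S(1) e unfolding monotone_set_fun_def is_arg_max_def by blast
    ultimately show ?thesis by (simp add: d_def)
  next
    case False
    have "OPT V f k powr \<theta> / (real k * c) * d powr (1 - \<theta>) \<le> Max (marginal f S ` (Sopt - S))"
      using max_ge[of S] False S opt by (auto simp: d_def mult_ac)
    also have "\<dots> \<le> marginal f S e"
      using e opt False assms(1)
      by (subst Max_le_iff) (auto simp: is_arg_max_linorder dest: finite_subset)
    finally show ?thesis by (simp add: d_def marginal_def)
  qed
qed

text \<open>The constant decreases given by \<open>powr_decrease\<close> add up. Every greedy step
  adds a new element, so \<open>card S\<close> counts the steps.\<close>

lemma greedy_gap_powr_le:
  fixes c \<theta> :: real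
  assumes "finite V" "f {} = 0" "monotone_set_fun V f" "submodular_sharp V f k c \<theta>"
    and "k > 0" "c \<ge> 1" "0 < \<theta>" "\<theta> \<le> 1"
    and "greedy_reach V f k S"
  shows "(OPT V f k - f S) powr \<theta> \<le> OPT V f k powr \<theta> * (1 - \<theta> * card S / (k * c))"
  using assms(9)
proof induction
  case start
  show ?case using assms(2) by simp
next
  case (step S e)
  let ?P = "OPT V f k"
  let ?d = "?P - f S" and ?d' = "?P - f (insert e S)" and ?t = "?P powr \<theta> / (k * c)"
  have "feasible V k S"
    using step assms(1) by (simp add: greedy_reach_feasible)
  then have d: "0 \<le> ?d" "finite S"
    using assms(1) le_OPT[of V k S f] by (auto simp: feasible_def dest: finite_subset)
  have "greedy_reach V f k (insert e S)"
    using step by (intro greedy_reach.step)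
  then have feas: "feasible V k (insert e S)"
    using assms(1) by (rule greedy_reach_feasible)
  then have d': "0 \<le> ?d'"
    using assms(1) le_OPT[of V k _ f] by fastforce
  have card: "card (insert e S) = Suc (card S)"
    using step.hyps d by (simp add: is_arg_max_def)
  have gap: "?d' \<le> ?d - ?t * ?d powr (1 - \<theta>)"
    using greedy_gap_step[OF assms(1,3,4) step.hyps(1,3)] .
  show ?case
  proof (cases "?d = 0")
    case True
    with gap d' have "?d' = 0" by simp
    \<comment> \<open>\<open>powr_decrease\<close> needs a positive gap. Once the gap is 0 it stays
      0, so it suffices that the right-hand side is nonnegative, which follows from
      \<open>\<theta> \<le> 1 \<le> c\<close> and feasibility.\<close>
    moreover have "\<theta> * card (insert e S) \<le> c * k"
      using feas assms by (intro mult_mono) (auto simp: feasible_def)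
    then have "\<theta> * card (insert e S) / (k * c) \<le> 1"
      using assms by (simp add: field_simps)
    ultimately show ?thesis by simp
  next
    case False
    then have "?d' powr \<theta> \<le> ?d powr \<theta> - \<theta> * ?t"
      using powr_decrease[OF assms(7,8) _ _ d' gap] d assms by simp
    also have "\<dots> \<le> ?P powr \<theta> * (1 - \<theta> * card S / (k * c)) - \<theta> * ?t"
      using step.IH by simp
    also have "\<dots> = ?P powr \<theta> * (1 - \<theta> * card (insert e S) / (k * c))"
      unfolding card by (simp add: algebra_simps add_divide_distrib diff_divide_distrib)
    finally show ?thesis .
  qed
qed

text \<open>Geometric decay, with each factor \<open>1 - 1 / (k * c)\<close> bounded by
  \<open>exp (- 1 / (k * c))\<close>.\<close>

lemma greedy_gap_exp_le:
  assumes "finite V" "f {} = 0" "monotone_set_fun V f" "submodular_sharp V f k c 0"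
    and "k > 0" "c \<ge> 1" "OPT V f k > 0"
    and "greedy_reach V f k S"
  shows "OPT V f k - f S \<le> OPT V f k * exp (- (card S / (k * c)))"
  using assms(8)
proof induction
  case start
  show ?case using assms(2) by simp
next
  case (step S e)
  let ?P = "OPT V f k"
  let ?d = "?P - f S" and ?r = "1 / (real k * c)"
  have "feasible V k S"
    using step assms(1) by (simp add: greedy_reach_feasible)
  then have d: "0 \<le> ?d" "finite S"
    using assms(1) le_OPT[of V k S f] by (auto simp: feasible_def dest: finite_subset)
  have card: "card (insert e S) = Suc (card S)"
    using step.hyps d by (simp add: is_arg_max_def)
  \<comment> \<open>A positive optimum makes \<open>?P powr 0\<close> equal to 1; for
    \<open>?P = 0\<close> it would be 0.\<close>
  have "?P - f (insert e S) \<le> ?d - ?r * ?d"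
    using greedy_gap_step[OF assms(1,3,4) step.hyps(1,3)] d assms(7) by simp
  also have "\<dots> = ?d * (1 - ?r)" by (simp add: algebra_simps)
  also have "\<dots> \<le> ?d * exp (- ?r)"
    using d exp_ge_add_one_self[of "- ?r"] by (intro mult_left_mono) auto
  also have "\<dots> \<le> ?P * exp (- (card S / (k * c))) * exp (- ?r)"
    using step.IH by (intro mult_right_mono) auto
  also have "\<dots> = ?P * exp (- (card (insert e S) / (k * c)))"
    unfolding card by (simp add: mult.assoc add_divide_distrib flip: exp_add)
  finally show ?case .
qed

section \<open>From the gap to the approximation ratio\<close>

lemma sharp_factor_nonneg: "0 \<le> sharp_factor c \<theta>"
  by (simp add: sharp_factor_def)

text \<open>At \<open>card S = k\<close> the quotient \<open>card S / (k * c)\<close> becomes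
  \<open>1 / c\<close>. For positive \<open>\<theta>\<close>, raising the bound to the power
  \<open>1 / \<theta>\<close> recovers the gap itself.\<close>

lemma greedy_gap_le_sharp_factor:
  assumes "finite V" "f {} = 0" "monotone_set_fun V f" "submodular_sharp V f k c \<theta>"
    and "k > 0" "c \<ge> 1" "0 \<le> \<theta>" "\<theta> \<le> 1" "OPT V f k > 0"
    and "greedy_reach V f k S" "card S = k"
  shows "OPT V f k - f S \<le> sharp_factor c \<theta> * OPT V f k"
proof (cases "\<theta> = 0")
  case True
  then show ?thesis
    using greedy_gap_exp_le[of V f k c S] assms by (simp add: sharp_factor_def mult_ac)
next
  case False
  let ?P = "OPT V f k"
  have d: "0 \<le> ?P - f S"
    using greedy_reach_feasible[OF assms(10,1)] le_OPT[of V k S f] assms(1) by simp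
  have "(?P - f S) powr \<theta> \<le> ?P powr \<theta> * (1 - \<theta> / c)"
    using greedy_gap_powr_le[of V f k c \<theta> S] assms False by simp
  then have "((?P - f S) powr \<theta>) powr (1 / \<theta>) \<le> (?P powr \<theta> * (1 - \<theta> / c)) powr (1 / \<theta>)"
    using assms(7) by (intro powr_mono2) auto
  also have "\<dots> = ?P * (1 - \<theta> / c) powr (1 / \<theta>)"
    using assms False by (subst powr_mult) (auto simp: powr_powr)
  finally show ?thesis
    using d False by (simp add: powr_powr sharp_factor_def mult_ac)
qed

theorem theorem3:
  fixes n k :: nat and V :: "nat set" and f :: "nat set \<Rightarrow> real" and c \<theta> :: real
  assumes "V = {1..n}"
    and "k > 0"
    and "\<And>S. S \<subseteq> V \<Longrightarrow> f S \<ge> 0"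
    and "f {} = 0"
    and "monotone_set_fun V f"
    and "submodular V f"
    and "c \<ge> 1" and "0 \<le> \<theta>" and "\<theta> \<le> 1"
    and "submodular_sharp V f k c \<theta>"
  shows "(\<exists>Sg. greedy_output V f k Sg) \<and>
    (\<forall>Sg. greedy_output V f k Sg \<longrightarrow>
       feasible V k Sg \<and>
       (\<forall>Sopt. optimal_solution V f k Sopt \<longrightarrow>
          f Sg \<ge> (1 - sharp_factor c \<theta>) * f Sopt))"
proof (intro conjI allI impI)
  have fin: "finite V" using assms(1) by simp
  show "\<exists>Sg. greedy_output V f k Sg"
    using fin by (rule greedy_output_exists)
  fix Sg assume Sg: "greedy_output V f k Sg"
  then have reach: "greedy_reach V f k Sg" by (simp add: greedy_output_def)
  then show feas: "feasible V k Sg"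
    using fin by (rule greedy_reach_feasible)
  fix Sopt assume "optimal_solution V f k Sopt"
  then have opt: "f Sopt = OPT V f k" "Sopt \<subseteq> V"
    by (auto simp: optimal_solution_def feasible_def)
  have nonneg: "0 \<le> OPT V f k"
    using le_OPT[of V k "{}" f] fin assms(4) by (simp add: feasible_def)
  \<comment> \<open>The gap estimate handles a full set with positive optimum. If the optimum is 0,
    nonnegativity of \<open>f\<close> suffices; if \<open>V\<close> is exhausted, \<open>Sg\<close>
    contains \<open>Sopt\<close> and is itself optimal by monotonicity.\<close>
  consider "card Sg = k" "OPT V f k > 0" | "OPT V f k = 0" | "V \<subseteq> Sg"
    using Sg feas nonneg by (force simp: greedy_output_def feasible_def)
  then show "(1 - sharp_factor c \<theta>) * f Sopt \<le> f Sg"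
  proof cases
    case 1
    then have "OPT V f k - f Sg \<le> sharp_factor c \<theta> * OPT V f k"
      using greedy_gap_le_sharp_factor[of V f k c \<theta> Sg] fin reach assms by simp
    then show ?thesis using opt by (simp add: algebra_simps)
  next
    case 2
    then show ?thesis using assms(3) feas opt by (simp add: feasible_def)
  next
    case 3
    have "(1 - sharp_factor c \<theta>) * f Sopt \<le> f Sopt"
      using opt nonneg sharp_factor_nonneg[of c \<theta>] by (simp add: algebra_simps)
    also have "\<dots> \<le> f Sg"
      using assms(5) 3 opt(2) feas unfolding monotone_set_fun_def feasible_def by blast
    finally show ?thesis .
  qed
qed

end
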